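(* Let $L$ be a finite lattice and let $f$ be a complementary choice function on $L$. Then there is a supermodular function $u:L\to\mathbb R$, which is moreover monotone and integer-valued, which generates $f$: for every $x\in L$, $f(x)$ is the least element of the set of maximizers of $u$ restricted to $L(x)=\{y\in L: y\le x\}$.
   Context: A choice function (CF) on a lattice $L$ is a map $f:L\to L$ with $f(x)\le x$ for all $x$. It is monotonic if $x\le y$ implies $f(x)\le f(y)$; consistent if $f(x)\le y\le x$ implies $f(y)=f(x)$; complementary if monotonic and consistent. A function $u:L\to\mathbb R$ is supermodular if $u(x)+u(y)\le u(x\wedge y)+u(x\vee y)$ for all $x,y\in L$; it is monotone if $x\le y$ implies $u(x)\le u(y)$. For supermodular $u$ and finite $L$, the set of maximizers of $u$ on $L(x)$ is a sublattice and hence has a least element. *)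

theory Defs
  imports Complex_Main
begin

definition choice_function :: "('a::order \<Rightarrow> 'a) \<Rightarrow> bool" where
  "choice_function f \<longleftrightarrow> (\<forall>x. f x \<le> x)"

definition consistent :: "('a::order \<Rightarrow> 'a) \<Rightarrow> bool" where
  "consistent f \<longleftrightarrow> (\<forall>x y. f x \<le> y \<and> y \<le> x \<longrightarrow> f y = f x)"

definition complementary :: "('a::order \<Rightarrow> 'a) \<Rightarrow> bool" where
  "complementary f \<longleftrightarrow> mono f \<and> consistent f"

definition supermodular :: "('a::lattice \<Rightarrow> real) \<Rightarrow> bool" where
  "supermodular u \<longleftrightarrow> (\<forall>x y. u x + u y \<le> u (inf x y) + u (sup x y))"

definition maximizers :: "('a \<Rightarrow> real) \<Rightarrow> 'a set \<Rightarrow> 'a set" where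
  "maximizers u S = {y. is_arg_max u (\<lambda>z. z \<in> S) y}"

definition is_least :: "'a::order set \<Rightarrow> 'a \<Rightarrow> bool" where
  "is_least S a \<longleftrightarrow> a \<in> S \<and> (\<forall>b\<in>S. a \<le> b)"

definition generates :: "('a::order \<Rightarrow> real) \<Rightarrow> ('a \<Rightarrow> 'a) \<Rightarrow> bool" where
  "generates u f \<longleftrightarrow> (\<forall>x. is_least (maximizers u {..x}) (f x))"

end

theory Submission
  imports Defs
begin

text \<open>
  A complementary choice function is an interior operator, and \<open>u x = 2 ^ card {..f x}\<close> works
  for the following reason. If \<open>f x\<close> and \<open>f y\<close> are comparable, the smaller one lies below
  \<open>inf x y\<close>, and monotonicity suffices. If not, both lie strictly below \<open>f (sup x y)\<close>, so that
  \<open>u\<close> at least doubles from \<open>x\<close> and from \<open>y\<close> to \<open>sup x y\<close>, which gives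
  \<open>u x + u y \<le> u (sup x y)\<close>.
\<close>

definition down_weight :: "'a::{finite, order} \<Rightarrow> real" where
  "down_weight x = 2 ^ card {..x}"

lemma down_weight_nonneg: "0 \<le> down_weight x"
  by (simp add: down_weight_def)

lemma down_weight_mono: "x \<le> y \<Longrightarrow> down_weight x \<le> down_weight y"
  by (simp add: down_weight_def card_mono)

text \<open>The down-set of \<open>y\<close> contains that of \<open>x\<close> and also
  \<open>y\<close> itself, so the exponent grows by at least one.\<close>

lemma down_weight_double:
  assumes "x < y"
  shows "2 * down_weight x \<le> down_weight y"
proof -
  have "{..x} \<subset> {..y}"
    using assms by (simp add: less_le_not_le)
  then have "Suc (card {..x}) \<le> card {..y}"
    by (simp add: psubset_card_mono Suc_leI)
  then have "(2::real) ^ Suc (card {..x}) \<le> 2 ^ card {..y}"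
    by (intro power_increasing) auto
  then show ?thesis
    by (simp add: down_weight_def)
qed

lemma down_weight_strict: "x < y \<Longrightarrow> down_weight x < down_weight y"
proof -
  assume "x < y"
  moreover have "0 < down_weight x"
    by (simp add: down_weight_def)
  ultimately show ?thesis
    using down_weight_double[of x y] by linarith
qed

lemma supermodular_down_weight:
  fixes f :: "'a::{finite, lattice} \<Rightarrow> 'a"
  assumes le: "\<And>x. f x \<le> x" and "mono f" and idem: "\<And>x. f (f x) = f x"
  shows "supermodular (\<lambda>x. down_weight (f x))"
proof -
  note mono = monoD[OF \<open>mono f\<close>]
  have comparable: "down_weight (f x) + down_weight (f y)
      \<le> down_weight (f (inf x y)) + down_weight (f (sup x y))" if "f x \<le> f y" for x y
  proof -
    have "f x \<le> inf x y"
      using le that by (meson le_inf_iff order_trans)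
    \<comment> \<open>Apply \<open>f\<close> to both sides; idempotence leaves the left one
      unchanged.\<close>
    then have "f x \<le> f (inf x y)"
      using mono idem by metis
    moreover have "f y \<le> f (sup x y)"
      by (simp add: mono)
    ultimately show ?thesis
      by (intro add_mono down_weight_mono)
  qed
  have "down_weight (f x) + down_weight (f y)
      \<le> down_weight (f (inf x y)) + down_weight (f (sup x y))" for x y
  proof (cases "f x \<le> f y \<or> f y \<le> f x")
    case True
    then show ?thesis
      using comparable[of x y] comparable[of y x]
      by (auto simp: inf_commute sup_commute add.commute)
  next
    case False
    have "f x \<le> f (sup x y)" "f y \<le> f (sup x y)"
      by (simp_all add: mono)
    \<comment> \<open>Equality in either case would make \<open>f x\<close> and \<open>f y\<close>
      comparable.\<close>
    with False have "f x < f (sup x y)" "f y < f (sup x y)"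
      by (auto simp: order.order_iff_strict)
    then show ?thesis
      using down_weight_double[of "f x"] down_weight_double[of "f y"]
        down_weight_nonneg[of "f (inf x y)"]
      by fastforce
  qed
  then show ?thesis
    by (simp add: supermodular_def)
qed

text \<open>For \<open>y \<le> x\<close>, monotonicity gives \<open>f y \<le> f x\<close>, and a
  strict inequality would cost weight. A maximizer \<open>y\<close> therefore has
  \<open>f y = f x\<close>, whence \<open>f x = f y \<le> y\<close>. By idempotence
  \<open>f x\<close> has the same value as \<open>x\<close>, so it is itself a maximizer.\<close>

lemma generates_down_weight:
  fixes f :: "'a::{finite, order} \<Rightarrow> 'a"
  assumes le: "\<And>x. f x \<le> x" and "mono f" and idem: "\<And>x. f (f x) = f x"
  shows "generates (\<lambda>x. down_weight (f x)) f"
  unfolding generates_def is_least_def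
proof (intro allI conjI ballI)
  note mono = monoD[OF \<open>mono f\<close>]
  fix x
  show "f x \<in> maximizers (\<lambda>x. down_weight (f x)) {..x}"
    by (auto simp: maximizers_def is_arg_max_def le idem not_less intro: down_weight_mono mono)
  fix y
  assume "y \<in> maximizers (\<lambda>x. down_weight (f x)) {..x}"
  then have "y \<le> x" and "\<not> down_weight (f y) < down_weight (f x)"
    by (auto simp: maximizers_def is_arg_max_def)
  then have "f y = f x"
    using mono down_weight_strict by (metis order.order_iff_strict)
  then show "f x \<le> y"
    using le by metis
qed

theorem theorem4:
  fixes f :: "'a::{finite, lattice} \<Rightarrow> 'a"
  assumes "choice_function f" and "complementary f"
  shows "\<exists>u :: 'a \<Rightarrow> real. supermodular u \<and> mono u \<and> (\<forall>x. u x \<in> \<int>) \<and> generates u f"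
proof -
  have le: "f x \<le> x" for x
    using assms(1) by (simp add: choice_function_def)
  have mono: "mono f" and "consistent f"
    using assms(2) by (simp_all add: complementary_def)
  \<comment> \<open>Consistency for the chain \<open>f x \<le> f x \<le> x\<close>, with
    \<open>f x\<close> as the middle element.\<close>
  then have idem: "f (f x) = f x" for x
    using le by (simp add: consistent_def)
  have "mono (\<lambda>x. down_weight (f x))"
    using mono by (auto intro!: monoI down_weight_mono dest: monoD)
  moreover have "\<forall>x. down_weight (f x) \<in> \<int>"
    by (simp add: down_weight_def)
  ultimately show ?thesis
    using supermodular_down_weight[OF le mono idem] generates_down_weight[OF le mono idem]
    by blast
qed

end
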